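(* Let $n\ge 2$ be a fixed integer and let $d=\binom n2$. For a positive integer $t$ let $N_{n,4t}$ be the number of $n\times 4t$ partial Hadamard matrices. Then $$N_{n,4t}=[1+o(1)]\,2^{2d-n+4nt+1}(8\pi t)^{-d/2}\qquad\text{as } t\to\infty .$$
   Context: An $n\times t$ partial Hadamard matrix is an $n\times t$ matrix with entries in $\{-1,1\}$ such that the inner product of any two distinct rows equals zero. *)

theory Defs
  imports
    "HOL-Library.Landau_Symbols"
    "Jordan_Normal_Form.Matrix"
begin

unbundle asymp_equiv_syntax

definition partial_hadamard :: "nat \<Rightarrow> nat \<Rightarrow> int mat \<Rightarrow> bool" where
  "partial_hadamard n t A \<longleftrightarrow>
     A \<in> carrier_mat n t \<and>
     (\<forall>i<n. \<forall>j<t. A $$ (i, j) \<in> {-1, 1}) \<and>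
     (\<forall>i<n. \<forall>j<n. i \<noteq> j \<longrightarrow> row A i \<bullet> row A j = 0)"

definition num_partial_hadamard :: "nat \<Rightarrow> nat \<Rightarrow> nat" where
  "num_partial_hadamard n t = card {A. partial_hadamard n t A}"

text \<open>The set counted above is finite, so its \<^const>\<open>card\<close> is a genuine cardinality.\<close>

lemma finite_partial_hadamard: "finite {A. partial_hadamard n t A}"
proof (rule finite_subset)
  let ?F = "({..<n} \<times> {..<t}) \<rightarrow>\<^sub>E ({-1, 1} :: int set)"
  show "{A. partial_hadamard n t A} \<subseteq> mat n t ` ?F"
  proof
    fix A assume "A \<in> {A. partial_hadamard n t A}"
    then have A: "A \<in> carrier_mat n t" "\<And>i j. i < n \<Longrightarrow> j < t \<Longrightarrow> A $$ (i, j) \<in> {-1, 1}"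
      by (auto simp: partial_hadamard_def)
    let ?f = "restrict (\<lambda>ij. A $$ ij) ({..<n} \<times> {..<t})"
    have "A = mat n t ?f"
      using A(1) by (intro eq_matI) auto
    moreover have "?f \<in> ?F"
      using A(2) by (intro restrict_PiE_iff[THEN iffD2]) auto
    ultimately show "A \<in> mat n t ` ?F" by (rule image_eqI)
  qed
  show "finite (mat n t ` ?F)"
    by (intro finite_imageI finite_PiE) auto
qed

end

theory Submission
  imports "HOL-Probability.Probability" Defs
begin

text \<open>
  Fix the number \<open>n\<close> of rows and put \<open>d = n choose 2\<close>. A column of the matrix is a sign vector
  \<open>x\<close>; it contributes the step \<open>(x\<^sub>i x\<^sub>j)\<close>, indexed by the pairs \<open>i < j\<close>, to a walk in \<open>\<int>\<^sup>d\<close>. The rows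
  are orthogonal exactly when the walk of \<open>m\<close> steps returns to the origin, so the count is
  \<open>2\<^bsup>nm\<^esup>\<close> times a return probability, and the theorem is a local limit theorem for this walk.

  Fourier inversion writes the return probability as the average of \<open>\<psi>(\<theta>)\<^sup>m\<close> over the torus
  \<open>(\<real>/2\<pi>\<int>)\<^sup>d\<close>, where \<open>\<psi>\<close> is the characteristic function of one step. Cut the torus into the \<open>4\<^sup>d\<close>
  cubes of side \<open>\<pi>/2\<close> centred at the points \<open>k\<pi>/2\<close>, with \<open>k\<close> having entries in \<open>{0, 1, 2, 3}\<close>
  (\<open>num_partial_hadamard_fourier\<close>). Three facts about \<open>\<psi>\<close> settle everything.

  \<^item> Domination (\<open>cmod_char_fun_gaussian_bound\<close>): on the cube around \<open>k\<pi>/2\<close>, at the point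
  \<open>k\<pi>/2 + \<phi>\<close>, the modulus of \<open>\<psi>\<close> is at most \<open>exp (- |\<phi>|\<^sup>2 / (3d))\<close>. This comes from
  \<open>|\<psi>(\<theta>)| \<le> max (|cos \<theta>\<^sub>e|, |sin \<theta>\<^sub>e|)\<close> for every single pair \<open>e\<close> (\<open>cmod_char_fun_le_max\<close>).

  \<^item> Behaviour at the centres (\<open>char_fun_quarter_shift\<close>): as \<open>\<i>\<^bsup>s\<^esup> = \<i> s\<close> for a sign \<open>s\<close>, shifting by
  \<open>k\<pi>/2\<close> multiplies the summand of \<open>x\<close> in \<open>\<psi>\<close> by a fixed power of \<open>\<i>\<close> and by the character
  \<open>\<chi>\<^sub>k(x) = \<Prod> (x\<^sub>i x\<^sub>j) ^ k\<^sub>i\<^sub>j\<close> of the group of sign vectors. If \<open>\<chi>\<^sub>k\<close> is trivial, the shift does not change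
  \<open>\<psi>\<^bsup>4t\<^esup>\<close>; if not, \<open>\<psi>\<close> vanishes at the centre by orthogonality of characters. Summing all characters
  shows that \<open>\<chi>\<^sub>k\<close> is trivial for exactly \<open>2 \<cdot> 4\<^sup>d / 2\<^sup>n\<close> of the \<open>k\<close> (\<open>card_trivial_exponents\<close>).

  \<^item> Central limit (\<open>char_fun_power_tendsto\<close>): the coordinates of a step have mean zero, variance one
  and are uncorrelated, hence \<open>\<psi>(\<theta>/\<surd>m)\<^sup>m\<close> tends to \<open>exp (- |\<theta>|\<^sup>2 / 2)\<close>.

  After rescaling by \<open>\<surd>m\<close>, with \<open>m = 4t\<close>, dominated convergence applies to each cube. The cubes with trivial
  \<open>\<chi>\<^sub>k\<close> contribute the Gaussian integral \<open>(2\<pi>)\<^bsup>d/2\<^esup>\<close> each and the others nothing. The constant in the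
  theorem is what remains: \<open>(2 \<cdot> 4\<^sup>d / 2\<^sup>n) (2\<pi>)\<^bsup>d/2\<^esup> / (2\<pi>\<surd>(4t))\<^sup>d = 2\<^bsup>2d-n+1\<^esup> (8\<pi>t)\<^bsup>-d/2\<^esup>\<close>.
\<close>

section \<open>Orthogonality of rows as closed walks\<close>

definition sign_vectors :: "nat \<Rightarrow> (nat \<Rightarrow> int) set" where
  "sign_vectors n = {..<n} \<rightarrow>\<^sub>E {-1, 1}"

definition row_pairs :: "nat \<Rightarrow> (nat \<times> nat) set" where
  "row_pairs n = (SIGMA j:{..<n}. {..<j})"

definition pair_product :: "(nat \<Rightarrow> int) \<Rightarrow> nat \<times> nat \<Rightarrow> int" where
  "pair_product x e = x (fst e) * x (snd e)"

lemma finite_sign_vectors [simp]: "finite (sign_vectors n)"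
  by (simp add: sign_vectors_def finite_PiE)

lemma card_sign_vectors: "card (sign_vectors n) = 2 ^ n"
  by (simp add: sign_vectors_def card_PiE numeral_2_eq_2)

lemma finite_row_pairs [simp]: "finite (row_pairs n)"
  by (simp add: row_pairs_def)

lemma card_row_pairs: "card (row_pairs n) = n choose 2"
proof -
  have "card (row_pairs n) = (\<Sum>j<n. j)"
    by (simp add: row_pairs_def)
  also have "\<dots> = n choose 2"
    by (induction n) (auto simp: numeral_2_eq_2)
  finally show ?thesis .
qed

lemma sign_vectorsD: "x \<in> sign_vectors n \<Longrightarrow> i < n \<Longrightarrow> x i = -1 \<or> x i = 1"
  by (auto simp: sign_vectors_def PiE_iff)

lemma pair_product_cases:
  assumes "x \<in> sign_vectors n" "e \<in> row_pairs n"
  shows "pair_product x e = -1 \<or> pair_product x e = 1"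
  using sign_vectorsD[OF assms(1), of "fst e"] sign_vectorsD[OF assms(1), of "snd e"] assms(2)
  by (auto simp: row_pairs_def pair_product_def)

text \<open>
  Reading a matrix column by column turns it into a sequence \<open>c\<close> of sign vectors, and the inner
  product of two rows into one coordinate of the end point of the walk with steps \<open>c l\<close>.
\<close>
lemma num_partial_hadamard_eq_card_closed_walks:
  "num_partial_hadamard n m =
     card {c \<in> {..<m} \<rightarrow>\<^sub>E sign_vectors n. \<forall>e\<in>row_pairs n. (\<Sum>l<m. pair_product (c l) e) = 0}"
proof -
  let ?C = "{c \<in> {..<m} \<rightarrow>\<^sub>E sign_vectors n. \<forall>e\<in>row_pairs n. (\<Sum>l<m. pair_product (c l) e) = 0}"
  let ?f = "\<lambda>A::int mat. \<lambda>l\<in>{..<m}. \<lambda>i\<in>{..<n}. A $$ (i, l)"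
  let ?g = "\<lambda>c. mat n m (\<lambda>(i, l). c l i)"
  have inner: "scalar_prod (row A i) (row A j) = (\<Sum>l<m. A $$ (i, l) * A $$ (j, l))"
    if "A \<in> carrier_mat n m" "i < n" "j < n" for A :: "int mat" and i j
    using that by (simp add: scalar_prod_def atLeast0LessThan)
  have "bij_betw ?f {A. partial_hadamard n m A} ?C"
  proof (rule bij_betw_byWitness[where f' = ?g])
    show "\<forall>A\<in>{A. partial_hadamard n m A}. ?g (?f A) = A"
      by (auto simp: partial_hadamard_def)
    show "\<forall>c\<in>?C. ?f (?g c) = c"
    proof
      fix c assume c: "c \<in> ?C"
      show "?f (?g c) = c"
      proof (intro ext)
        fix l i
        show "?f (?g c) l i = c l i"
          using c by (cases "l < m"; cases "i < n")
            (auto simp: sign_vectors_def PiE_iff extensional_def)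
      qed
    qed
    show "?f ` {A. partial_hadamard n m A} \<subseteq> ?C"
    proof (rule image_subsetI)
      fix A assume "A \<in> {A. partial_hadamard n m A}"
      then have A: "A \<in> carrier_mat n m" "\<And>i j. i < n \<Longrightarrow> j < m \<Longrightarrow> A $$ (i, j) \<in> {-1, 1}"
        "\<And>i j. i < n \<Longrightarrow> j < n \<Longrightarrow> i \<noteq> j \<Longrightarrow> scalar_prod (row A i) (row A j) = 0"
        by (auto simp: partial_hadamard_def)
      have "(\<Sum>l<m. pair_product (?f A l) (j, i)) = 0" if "j < n" "i < j" for i j
        using A(3)[of j i] inner[OF A(1), of j i] that by (simp add: pair_product_def)
      then show "?f A \<in> ?C"
        using A(2) by (auto simp: row_pairs_def sign_vectors_def PiE_iff)
    qed
    show "?g ` ?C \<subseteq> {A. partial_hadamard n m A}"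
    proof (rule image_subsetI)
      fix c assume c: "c \<in> ?C"
      have *: "(\<Sum>l<m. c l j * c l i) = 0" if "j < n" "i < j" for i j
        using c that by (auto simp: row_pairs_def pair_product_def)
      have "(\<Sum>l<m. c l i * c l j) = 0" if "i < n" "j < n" "i \<noteq> j" for i j
        using *[of i j] *[of j i] that by (cases "i < j") (simp_all add: mult.commute)
      then have "scalar_prod (row (?g c) i) (row (?g c) j) = 0" if "i < n" "j < n" "i \<noteq> j" for i j
        using that by (subst inner) auto
      moreover have "c l i = -1 \<or> c l i = 1" if "l < m" "i < n" for l i
        using c that by (intro sign_vectorsD[of _ n]) auto
      ultimately show "?g c \<in> {A. partial_hadamard n m A}"
        by (auto simp: partial_hadamard_def)
    qed
  qed
  then show ?thesis
    unfolding num_partial_hadamard_def by (rule bij_betw_same_card)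
qed

section \<open>Sums over sign vectors and their characters\<close>


text \<open>
  Changing the sign of one coordinate permutes the sign vectors. Averaging over such flips is the
  source of the vanishing sums below and of the bound on the characteristic function.
\<close>
lemma sum_sign_vectors_flip:
  assumes "a < n"
  shows "(\<Sum>x\<in>sign_vectors n. f (x(a := - x a))) = (\<Sum>x\<in>sign_vectors n. f x)"
  using assms
  by (intro sum.reindex_bij_witness[where i = "\<lambda>x. x(a := - x a)" and j = "\<lambda>x. x(a := - x a)"])
     (auto simp: sign_vectors_def PiE_iff extensional_def)

lemma pair_product_flip:
  "fst e \<noteq> snd e \<Longrightarrow> pair_product (x(a := - x a)) e =
     (if a = fst e \<or> a = snd e then - pair_product x e else pair_product x e)"
  by (auto simp: pair_product_def)

lemma row_pairs_irrefl: "e \<in> row_pairs n \<Longrightarrow> fst e \<noteq> snd e"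
  by (auto simp: row_pairs_def)

lemma row_pairs_less: "e \<in> row_pairs n \<Longrightarrow> fst e < n" "e \<in> row_pairs n \<Longrightarrow> snd e < n"
  by (auto simp: row_pairs_def)

lemma sum_eq_zero_of_flip_sign:
  fixes f :: "(nat \<Rightarrow> int) \<Rightarrow> real"
  assumes "a < n" "\<And>x. x \<in> sign_vectors n \<Longrightarrow> f (x(a := - x a)) = - f x"
  shows "(\<Sum>x\<in>sign_vectors n. f x) = 0"
proof -
  have "(\<Sum>x\<in>sign_vectors n. f x) = (\<Sum>x\<in>sign_vectors n. - f x)"
    using sum_sign_vectors_flip[OF assms(1), of f] assms(2) by simp
  then show ?thesis by (simp add: sum_negf)
qed

lemma sum_pair_product:
  assumes "e \<in> row_pairs n"
  shows "(\<Sum>x\<in>sign_vectors n. real_of_int (pair_product x e)) = 0"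
  using assms
  by (intro sum_eq_zero_of_flip_sign[where a = "fst e"])
     (auto simp: pair_product_flip row_pairs_irrefl row_pairs_less)

text \<open>
  Two different pairs are told apart by an index that lies in exactly one of them; flipping that
  coordinate changes the sign of the product.
\<close>
lemma sum_pair_product_mult:
  assumes e: "e \<in> row_pairs n" and f: "f \<in> row_pairs n"
  shows "(\<Sum>x\<in>sign_vectors n. real_of_int (pair_product x e) * real_of_int (pair_product x f)) =
           (if e = f then 2 ^ n else 0)"
proof (cases "e = f")
  case True
  have "real_of_int (pair_product x e) * real_of_int (pair_product x e) = 1"
    if "x \<in> sign_vectors n" for x
    using pair_product_cases[OF that e] by auto
  with True show ?thesis by (simp add: card_sign_vectors)
next
  case False
  obtain a where "a < n" "(a = fst e \<or> a = snd e) \<noteq> (a = fst f \<or> a = snd f)"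
  proof -
    have "\<exists>a\<in>{fst e, snd e, fst f, snd f}. (a = fst e \<or> a = snd e) \<noteq> (a = fst f \<or> a = snd f)"
      using False e f by (auto simp: row_pairs_def prod_eq_iff)
    then show thesis
      using that row_pairs_less[OF e] row_pairs_less[OF f] by blast
  qed
  then have "(\<Sum>x\<in>sign_vectors n. real_of_int (pair_product x e) * real_of_int (pair_product x f)) = 0"
    using row_pairs_irrefl[OF e] row_pairs_irrefl[OF f]
    by (intro sum_eq_zero_of_flip_sign[where a = a]) (auto simp: pair_product_flip)
  with False show ?thesis by simp
qed

text \<open>
  The homomorphism from the group of sign vectors to \<open>{-1, 1}\<close> given by the multigraph on the rows
  in which the edge \<open>e\<close> has multiplicity \<open>k e\<close>.
\<close>
definition pair_character :: "nat \<Rightarrow> (nat \<times> nat \<Rightarrow> nat) \<Rightarrow> (nat \<Rightarrow> int) \<Rightarrow> int" where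
  "pair_character n k x = (\<Prod>e\<in>row_pairs n. pair_product x e ^ k e)"

lemma pair_character_cases:
  assumes "x \<in> sign_vectors n"
  shows "pair_character n k x = -1 \<or> pair_character n k x = 1"
proof -
  have "\<bar>pair_character n k x\<bar> = (\<Prod>e\<in>row_pairs n. 1)"
    unfolding pair_character_def abs_prod
  proof (intro prod.cong refl)
    fix e assume "e \<in> row_pairs n"
    from pair_product_cases[OF assms this] show "\<bar>pair_product x e ^ k e\<bar> = 1"
      by (auto simp: power_abs)
  qed
  then show ?thesis by simp linarith
qed

text \<open>
  A nontrivial character takes the value \<open>-1\<close> at some \<open>s\<close>, and multiplication by \<open>s\<close> permutes the
  sign vectors while it negates the character.
\<close>
lemma sum_pair_character:
  "(\<Sum>x\<in>sign_vectors n. pair_character n k x) =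
     (if \<forall>x\<in>sign_vectors n. pair_character n k x = 1 then 2 ^ n else 0)"
proof (cases "\<forall>x\<in>sign_vectors n. pair_character n k x = 1")
  case True
  then show ?thesis by (simp add: card_sign_vectors)
next
  case False
  then obtain s where s: "s \<in> sign_vectors n" "pair_character n k s = -1"
    using pair_character_cases by blast
  let ?mul = "\<lambda>x. \<lambda>i\<in>{..<n}. s i * x i"
  have mem: "?mul x \<in> sign_vectors n" if "x \<in> sign_vectors n" for x
  proof -
    have "s i * x i = -1 \<or> s i * x i = 1" if "i < n" for i
      using sign_vectorsD[OF s(1) that] sign_vectorsD[OF \<open>x \<in> sign_vectors n\<close> that] by auto
    then show ?thesis by (auto simp: sign_vectors_def PiE_iff)
  qed
  have inv: "?mul (?mul x) = x" if "x \<in> sign_vectors n" for x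
  proof
    fix i show "?mul (?mul x) i = x i"
      using sign_vectorsD[OF s(1), of i] that
      by (cases "i < n") (auto simp: sign_vectors_def PiE_iff extensional_def)
  qed
  have "pair_character n k (?mul x) = - pair_character n k x" for x
  proof -
    have "pair_product (?mul x) e = pair_product s e * pair_product x e" if "e \<in> row_pairs n" for e
      using row_pairs_less[OF that] by (simp add: pair_product_def)
    then have "pair_character n k (?mul x) = pair_character n k s * pair_character n k x"
      by (simp add: pair_character_def power_mult_distrib flip: prod.distrib)
    with s show ?thesis by simp
  qed
  moreover have "(\<Sum>x\<in>sign_vectors n. pair_character n k (?mul x)) =
      (\<Sum>x\<in>sign_vectors n. pair_character n k x)"
    by (intro sum.reindex_bij_witness[where i = ?mul and j = ?mul]) (simp_all only: mem inv)
  ultimately have "(\<Sum>x\<in>sign_vectors n. pair_character n k x) = 0"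
    by (simp add: sum_negf)
  with False show ?thesis by simp
qed

definition trivial_exponents :: "nat \<Rightarrow> (nat \<times> nat \<Rightarrow> nat) set" where
  "trivial_exponents n =
     {k \<in> row_pairs n \<rightarrow>\<^sub>E {..<4}. \<forall>x\<in>sign_vectors n. pair_character n k x = 1}"

text \<open>
  Sum \<open>\<chi>\<^sub>k(x)\<close> over all \<open>k\<close> and all \<open>x\<close>. Summing over \<open>x\<close> first gives \<open>2\<^sup>n\<close> for each trivial
  character. Summing over \<open>k\<close> first gives a product of the sums \<open>1 + s + s\<^sup>2 + s\<^sup>3\<close> with
  \<open>s = x\<^sub>i x\<^sub>j\<close>, which vanish for \<open>s = -1\<close>; only the two constant vectors \<open>x\<close> survive, each with
  \<open>4\<^sup>d\<close>.
\<close>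
lemma card_trivial_exponents:
  assumes "n \<ge> 1"
  shows "2 ^ n * card (trivial_exponents n) = 2 * 4 ^ (n choose 2)"
proof -
  let ?K = "row_pairs n \<rightarrow>\<^sub>E {..<4::nat}"
  define one where "one = (\<lambda>i\<in>{..<n}. 1 :: int)"
  define minus where "minus = (\<lambda>i\<in>{..<n}. -1 :: int)"
  have finK: "finite ?K" by (intro finite_PiE) auto
  have geom: "(\<Sum>k<4. p ^ k) = (if p = 1 then 4 else 0)" if "p = -1 \<or> p = 1" for p :: int
    using that by (auto simp: numeral_eq_Suc)
  have const: "(\<forall>e\<in>row_pairs n. pair_product x e = 1) \<longleftrightarrow> x \<in> {one, minus}"
    if x: "x \<in> sign_vectors n" for x
  proof
    assume *: "\<forall>e\<in>row_pairs n. pair_product x e = 1"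
    have "x i = x 0" if "i < n" for i
    proof (cases "i = 0")
      case False
      then have "x i * x 0 = 1"
        using * that by (auto simp: row_pairs_def pair_product_def)
      then show ?thesis using sign_vectorsD[OF x that] by auto
    qed simp
    moreover have "x i = undefined" if "\<not> i < n" for i
      using x that by (auto simp: sign_vectors_def PiE_iff extensional_def)
    ultimately have "x = (\<lambda>i\<in>{..<n}. x 0)"
      unfolding restrict_def fun_eq_iff by (metis lessThan_iff)
    moreover have "x 0 = -1 \<or> x 0 = 1" using assms by (intro sign_vectorsD[OF x]) simp
    ultimately show "x \<in> {one, minus}" by (auto simp: one_def minus_def)
  next
    assume "x \<in> {one, minus}"
    then show "\<forall>e\<in>row_pairs n. pair_product x e = 1"
      by (auto simp: pair_product_def row_pairs_def one_def minus_def)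
  qed
  have "int (2 ^ n * card (trivial_exponents n)) =
      (\<Sum>k\<in>?K. if \<forall>x\<in>sign_vectors n. pair_character n k x = 1 then 2 ^ n else 0)"
    using finK by (simp add: trivial_exponents_def sum.If_cases Int_def)
  also have "\<dots> = (\<Sum>k\<in>?K. \<Sum>x\<in>sign_vectors n. pair_character n k x)"
    by (simp add: sum_pair_character)
  also have "\<dots> = (\<Sum>x\<in>sign_vectors n. \<Sum>k\<in>?K. pair_character n k x)"
    by (rule sum.swap)
  also have "\<dots> = (\<Sum>x\<in>sign_vectors n. \<Prod>e\<in>row_pairs n. \<Sum>k<4. pair_product x e ^ k)"
    unfolding pair_character_def by (intro sum.cong refl prod_sum_PiE[symmetric]) auto
  also have "\<dots> = (\<Sum>x\<in>sign_vectors n. \<Prod>e\<in>row_pairs n. if pair_product x e = 1 then 4 else 0)"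
  proof (intro sum.cong prod.cong refl)
    fix x e assume "x \<in> sign_vectors n" "e \<in> row_pairs n"
    then show "(\<Sum>k<4. pair_product x e ^ k) = (if pair_product x e = 1 then 4 else 0)"
      by (intro geom pair_product_cases)
  qed
  also have "\<dots> = (\<Sum>x\<in>sign_vectors n. if x \<in> {one, minus} then 4 ^ (n choose 2) else 0)"
  proof (intro sum.cong refl)
    fix x assume "x \<in> sign_vectors n"
    have "(\<Prod>e\<in>row_pairs n. if pair_product x e = 1 then 4 else 0) =
        (if \<forall>e\<in>row_pairs n. pair_product x e = 1 then 4 ^ (n choose 2) else (0::int))"
      by (simp add: card_row_pairs prod_zero_iff)
    with const[OF \<open>x \<in> sign_vectors n\<close>]
    show "(\<Prod>e\<in>row_pairs n. if pair_product x e = 1 then 4 else 0) =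
        (if x \<in> {one, minus} then 4 ^ (n choose 2) else (0::int))"
      by (simp only:)
  qed
  also have "\<dots> = 2 * 4 ^ (n choose 2)"
  proof -
    have "one 0 \<noteq> minus 0" using assms by (simp add: one_def minus_def)
    then have "one \<noteq> minus" by auto
    moreover have "sign_vectors n \<inter> {x. x \<in> {one, minus}} = {one, minus}"
      by (auto simp: sign_vectors_def one_def minus_def split: if_splits)
    ultimately show ?thesis
      by (simp add: sum.If_cases)
  qed
  finally have "int (2 ^ n * card (trivial_exponents n)) = int (2 * 4 ^ (n choose 2))"
    by (simp only: of_nat_mult of_nat_power of_nat_numeral)
  then show ?thesis
    by (simp only: of_nat_eq_iff)
qed

section \<open>The characteristic function of one step\<close>

definition phase :: "nat \<Rightarrow> (nat \<times> nat \<Rightarrow> real) \<Rightarrow> (nat \<Rightarrow> int) \<Rightarrow> real" where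
  "phase n \<theta> x = (\<Sum>e\<in>row_pairs n. \<theta> e * real_of_int (pair_product x e))"

definition char_fun :: "nat \<Rightarrow> (nat \<times> nat \<Rightarrow> real) \<Rightarrow> complex" where
  "char_fun n \<theta> = (\<Sum>x\<in>sign_vectors n. iexp (phase n \<theta> x)) / 2 ^ n"

lemma cmod_char_fun_le_1: "cmod (char_fun n \<theta>) \<le> 1"
proof -
  have "cmod (\<Sum>x\<in>sign_vectors n. iexp (phase n \<theta> x)) \<le> (\<Sum>x\<in>sign_vectors n. 1)"
    by (rule sum_norm_le) simp
  then show ?thesis
    by (simp add: char_fun_def norm_divide norm_power card_sign_vectors)
qed

text \<open>
  Write the four phases as \<open>r \<plusminus> u \<plusminus> v \<plusminus> w\<close>, where the sign of \<open>w\<close> is the product of the other two. The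
  sum then factors as \<open>4 e\<^bsup>ir\<^esup> (cos u cos v cos w - \<i> sin u sin v sin w)\<close>, and the bound follows by
  estimating both factors that contain \<open>w\<close> by their maximum.
\<close>
lemma cmod_sum_four_phases_le:
  fixes p0 pa pb pab :: real
  defines "w \<equiv> (p0 - pa - pb + pab) / 4"
  shows "cmod (iexp p0 + iexp pa + iexp pb + iexp pab) \<le> 4 * max \<bar>cos w\<bar> \<bar>sin w\<bar>"
proof -
  define r u v where "r = (p0 + pa + pb + pab) / 4" and "u = (p0 - pa + pb - pab) / 4"
    and "v = (p0 + pa - pb - pab) / 4"
  have p: "p0 = r + (u + v + w)" "pa = r + (v - u - w)" "pb = r + (u - v - w)" "pab = r + (w - u - v)"
    by (simp_all add: r_def u_def v_def w_def field_simps)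
  let ?c = "cos u * cos v * cos w" and ?s = "sin u * sin v * sin w"
  have "cis (u + v + w) + cis (v - u - w) + cis (u - v - w) + cis (w - u - v) = 4 * Complex ?c (- ?s)"
    by (simp add: complex_eq_iff cos_add cos_diff sin_add sin_diff algebra_simps)
  moreover have "iexp (r + y) = cis r * cis y" for y
    by (simp only: cis_conv_exp[symmetric] cis_mult)
  ultimately have "iexp p0 + iexp pa + iexp pb + iexp pab = cis r * (4 * Complex ?c (- ?s))"
    unfolding p by (simp only: distrib_left[symmetric])
  then have norm: "cmod (iexp p0 + iexp pa + iexp pb + iexp pab) = 4 * sqrt (?c\<^sup>2 + ?s\<^sup>2)"
    by (simp add: norm_mult complex_norm)
  define M where "M = max \<bar>cos w\<bar> \<bar>sin w\<bar>"
  have M: "(cos w)\<^sup>2 \<le> M\<^sup>2" "(sin w)\<^sup>2 \<le> M\<^sup>2" "0 \<le> M"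
    unfolding M_def by (simp_all flip: abs_le_square_iff)
  have "?c\<^sup>2 + ?s\<^sup>2 \<le> (cos u)\<^sup>2 * M\<^sup>2 + (sin u)\<^sup>2 * M\<^sup>2"
  proof (rule add_mono)
    have "(cos v)\<^sup>2 * (cos w)\<^sup>2 \<le> 1 * M\<^sup>2"
      by (intro mult_mono M(1)) (auto simp: abs_square_le_1)
    then show "?c\<^sup>2 \<le> (cos u)\<^sup>2 * M\<^sup>2"
      by (simp add: power_mult_distrib mult.assoc mult_left_mono)
    have "(sin v)\<^sup>2 * (sin w)\<^sup>2 \<le> 1 * M\<^sup>2"
      by (intro mult_mono M(2)) (auto simp: abs_square_le_1)
    then show "?s\<^sup>2 \<le> (sin u)\<^sup>2 * M\<^sup>2"
      by (simp add: power_mult_distrib mult.assoc mult_left_mono)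
  qed
  also have "\<dots> = M\<^sup>2"
    by (simp flip: distrib_right)
  \<comment> \<open>Here \<open>cos\<^sup>2 u + sin\<^sup>2 u = 1\<close> has absorbed the remaining angle.\<close>
  finally have "sqrt (?c\<^sup>2 + ?s\<^sup>2) \<le> M"
    using M(3) by (intro real_le_lsqrt) auto
  then show ?thesis by (simp add: norm M_def)
qed

text \<open>
  The second difference under the flips of the two coordinates of \<open>e\<close> isolates the term of \<open>e\<close>: any
  other pair contains at most one of them, so its term cancels.
\<close>
lemma phase_mixed_difference:
  assumes e: "e \<in> row_pairs n"
  defines "a \<equiv> fst e" and "b \<equiv> snd e"
  shows "phase n \<theta> x - phase n \<theta> (x(a := - x a)) - phase n \<theta> (x(b := - x b))
           + phase n \<theta> ((x(b := - x b))(a := - (x(b := - x b)) a))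
         = 4 * (\<theta> e * real_of_int (pair_product x e))"
proof -
  have "phase n \<theta> x - phase n \<theta> (x(a := - x a)) - phase n \<theta> (x(b := - x b))
           + phase n \<theta> ((x(b := - x b))(a := - (x(b := - x b)) a))
      = (\<Sum>f\<in>row_pairs n. \<theta> f * real_of_int (pair_product x f - pair_product (x(a := - x a)) f
           - pair_product (x(b := - x b)) f
           + pair_product ((x(b := - x b))(a := - (x(b := - x b)) a)) f))"
    unfolding phase_def
    by (simp only: sum_subtractf[symmetric] sum.distrib[symmetric]) (simp add: algebra_simps)
  also have "\<dots> = (\<Sum>f\<in>row_pairs n. if f = e then 4 * (\<theta> e * real_of_int (pair_product x e)) else 0)"
  proof (intro sum.cong refl)
    fix f assume f: "f \<in> row_pairs n"
    have ne: "fst f \<noteq> snd f" by (rule row_pairs_irrefl[OF f])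
    have "f = e" if "(a = fst f \<or> a = snd f)" "(b = fst f \<or> b = snd f)"
      using e f that by (auto simp: row_pairs_def a_def b_def)
    then show "\<theta> f * real_of_int (pair_product x f - pair_product (x(a := - x a)) f
           - pair_product (x(b := - x b)) f
           + pair_product ((x(b := - x b))(a := - (x(b := - x b)) a)) f) =
        (if f = e then 4 * (\<theta> e * real_of_int (pair_product x e)) else 0)"
      unfolding pair_product_flip[OF ne]
      by (cases "f = e") (auto simp: a_def b_def)
  qed
  also have "\<dots> = 4 * (\<theta> e * real_of_int (pair_product x e))"
    using e by simp
  finally show ?thesis .
qed

text \<open>
  Grouping the sign vectors in fours, by flips of the two coordinates of \<open>e\<close>, makes
  \<open>cmod_sum_four_phases_le\<close> applicable to each group with \<open>w = \<plusminus> \<theta>\<^sub>e\<close>.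
\<close>
lemma cmod_char_fun_le_max:
  assumes e: "e \<in> row_pairs n"
  shows "cmod (char_fun n \<theta>) \<le> max \<bar>cos (\<theta> e)\<bar> \<bar>sin (\<theta> e)\<bar>"
proof -
  define a b where "a = fst e" and "b = snd e"
  have ab: "a < n" "b < n"
    using row_pairs_less[OF e] by (simp_all add: a_def b_def)
  let ?p = "phase n \<theta>" and ?M = "max \<bar>cos (\<theta> e)\<bar> \<bar>sin (\<theta> e)\<bar>"
  let ?fa = "\<lambda>x::nat \<Rightarrow> int. x(a := - x a)" and ?fb = "\<lambda>x::nat \<Rightarrow> int. x(b := - x b)"
  have "4 * (\<Sum>x\<in>sign_vectors n. iexp (?p x)) =
      (\<Sum>x\<in>sign_vectors n. iexp (?p x) + iexp (?p (?fa x)) + iexp (?p (?fb x)) + iexp (?p (?fa (?fb x))))"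
    unfolding sum.distrib sum_sign_vectors_flip[OF ab(2), of "\<lambda>x. iexp (?p (?fa x))"]
      sum_sign_vectors_flip[OF ab(2), of "\<lambda>x. iexp (?p x)"]
      sum_sign_vectors_flip[OF ab(1), of "\<lambda>x. iexp (?p x)"]
    by simp
  also have "cmod \<dots> \<le> (\<Sum>x\<in>sign_vectors n. 4 * ?M)"
  proof (rule sum_norm_le)
    fix x assume x: "x \<in> sign_vectors n"
    have *: "(?p x - ?p (?fa x) - ?p (?fb x) + ?p (?fa (?fb x))) / 4 = \<theta> e * real_of_int (pair_product x e)"
      using phase_mixed_difference[OF e, of \<theta> x] by (simp add: a_def b_def)
    show "cmod (iexp (?p x) + iexp (?p (?fa x)) + iexp (?p (?fb x)) + iexp (?p (?fa (?fb x)))) \<le> 4 * ?M"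
      using cmod_sum_four_phases_le[of "?p x" "?p (?fa x)" "?p (?fb x)" "?p (?fa (?fb x))"]
        pair_product_cases[OF x e] unfolding * by auto
  qed
  finally show ?thesis
    by (simp add: char_fun_def norm_mult norm_divide norm_power card_sign_vectors field_simps)
qed

lemma cos_le_exp_neg_square:
  fixes x :: real
  assumes "\<bar>x\<bar> \<le> 1"
  shows "cos x \<le> exp (- x\<^sup>2 / 3)"
proof -
  have "cmod (iexp x - (\<Sum>k\<le>2. (\<i> * x) ^ k / fact k)) \<le> \<bar>x\<bar> ^ 3 / 6"
    using iexp_approx1[of x 2] by (simp add: fact_numeral eval_nat_numeral)
  then have "Re (iexp x - (\<Sum>k\<le>2. (\<i> * x) ^ k / fact k)) \<le> \<bar>x\<bar> ^ 3 / 6"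
    using complex_Re_le_cmod order_trans by blast
  then have "cos x \<le> 1 - x\<^sup>2 / 2 + \<bar>x\<bar> ^ 3 / 6"
    by (simp add: numeral_2_eq_2 Re_exp)
  \<comment> \<open>The cubic error costs a third of the quadratic term, which leaves the constant \<open>1/3\<close>.\<close>
  also have "\<bar>x\<bar> ^ 3 \<le> x\<^sup>2"
    using power_decreasing[of 2 3 "\<bar>x\<bar>"] assms by simp
  also have "1 - x\<^sup>2 / 2 + x\<^sup>2 / 6 = 1 + (- x\<^sup>2 / 3)"
    by simp
  also have "\<dots> \<le> exp (- x\<^sup>2 / 3)"
    by (rule exp_ge_add_one_self)
  finally show ?thesis by simp
qed

text \<open>
  A shift by \<open>\<pi>/2\<close> only interchanges \<open>|cos|\<close> and \<open>|sin|\<close>, and \<open>|sin x| \<le> cos x\<close> within \<open>\<pi>/4\<close> of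
  zero.
\<close>
lemma abs_cos_sin_quarter_shift_le:
  fixes x :: real and k :: nat
  assumes x: "\<bar>x\<bar> \<le> pi / 4"
  shows "max \<bar>cos (x + real k * (pi / 2))\<bar> \<bar>sin (x + real k * (pi / 2))\<bar> \<le> cos x"
proof -
  have pos: "0 \<le> cos x"
    using x by (intro cos_ge_zero) auto
  have "0 \<le> cos (2 * x)"
    using x by (intro cos_ge_zero) auto
  then have "(sin x)\<^sup>2 \<le> (cos x)\<^sup>2"
    by (simp add: cos_double)
  then have le: "\<bar>sin x\<bar> \<le> cos x"
    using pos by (simp flip: abs_le_square_iff)
  have "{\<bar>cos (x + real k * (pi / 2))\<bar>, \<bar>sin (x + real k * (pi / 2))\<bar>} = {\<bar>cos x\<bar>, \<bar>sin x\<bar>}"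
  proof (induction k)
    case (Suc k)
    define y where "y = x + real k * (pi / 2)"
    have "x + real (Suc k) * (pi / 2) = y + pi / 2"
      by (simp add: y_def field_simps)
    moreover have "\<bar>cos (y + pi / 2)\<bar> = \<bar>sin y\<bar>" "\<bar>sin (y + pi / 2)\<bar> = \<bar>cos y\<bar>"
      by (simp_all add: cos_add sin_add)
    ultimately show ?case
      using Suc unfolding y_def[symmetric] by (simp add: insert_commute)
  qed simp
  then have "\<bar>cos (x + real k * (pi / 2))\<bar> \<in> {\<bar>cos x\<bar>, \<bar>sin x\<bar>}"
    "\<bar>sin (x + real k * (pi / 2))\<bar> \<in> {\<bar>cos x\<bar>, \<bar>sin x\<bar>}"
    by blast+
  with le pos show ?thesis by auto
qed

text \<open>
  The bound for a single pair is used at the largest \<open>\<phi>\<^sub>e\<^sup>2\<close>, which is at least the average of them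
  all; hence the division by the number of pairs. The result is a product of functions of one variable
  each and so can serve as an integrable majorant.
\<close>
lemma cmod_char_fun_gaussian_bound:
  assumes n: "n \<ge> 2" and \<phi>: "\<And>e. e \<in> row_pairs n \<Longrightarrow> \<bar>\<phi> e\<bar> \<le> pi / 4"
  shows "cmod (char_fun n (\<lambda>e. \<phi> e + real (k e) * (pi / 2)))
           \<le> exp (- (\<Sum>e\<in>row_pairs n. (\<phi> e)\<^sup>2) / (3 * real (n choose 2)))"
proof -
  let ?E = "row_pairs n"
  have ne: "?E \<noteq> {}"
  proof -
    have "(1, 0) \<in> ?E" using n by (simp add: row_pairs_def)
    then show ?thesis by blast
  qed
  define M where "M = Max ((\<lambda>e. (\<phi> e)\<^sup>2) ` ?E)"
  obtain e where e: "e \<in> ?E" "M = (\<phi> e)\<^sup>2"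
  proof -
    have "M \<in> (\<lambda>e. (\<phi> e)\<^sup>2) ` ?E"
      unfolding M_def using ne by (intro Max_in) simp_all
    then show thesis using that by blast
  qed
  have "(\<Sum>e\<in>?E. (\<phi> e)\<^sup>2) \<le> real (card ?E) * M"
    by (rule sum_bounded_above) (simp add: M_def)
  then have avg: "(\<Sum>e\<in>?E. (\<phi> e)\<^sup>2) / real (n choose 2) \<le> (\<phi> e)\<^sup>2"
    using n by (simp add: card_row_pairs e(2) field_simps)
  have "cmod (char_fun n (\<lambda>e. \<phi> e + real (k e) * (pi / 2))) \<le> cos (\<phi> e)"
    using cmod_char_fun_le_max[OF e(1)] abs_cos_sin_quarter_shift_le[OF \<phi>[OF e(1)]]
    by (rule order_trans)
  also have "\<dots> \<le> exp (- (\<phi> e)\<^sup>2 / 3)"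
    using \<phi>[OF e(1)] pi_less_4 by (intro cos_le_exp_neg_square) linarith
  also have "\<dots> \<le> exp (- (\<Sum>e\<in>?E. (\<phi> e)\<^sup>2) / (3 * real (n choose 2)))"
    using avg by (simp add: field_simps)
  finally show ?thesis .
qed

text \<open>
  For a sign \<open>s\<close> one has \<open>e\<^bsup>i\<pi>s/2\<^esup> = \<i> s\<close>, so a quarter-turn phase becomes multiplicative in the
  sign vector.
\<close>
lemma iexp_phase_quarter_shift:
  assumes x: "x \<in> sign_vectors n"
  shows "iexp (phase n (\<lambda>e. \<phi> e + real (k e) * (pi / 2)) x) =
     \<i> ^ (\<Sum>e\<in>row_pairs n. k e) * of_int (pair_character n k x) * iexp (phase n \<phi> x)"
proof -
  have quarter: "iexp (real (k e) * (pi / 2) * real_of_int (pair_product x e)) =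
      (\<i> * of_int (pair_product x e)) ^ k e" if "e \<in> row_pairs n" for e
  proof -
    have "iexp (real (k e) * (pi / 2) * real_of_int (pair_product x e)) =
        cis (pi / 2 * real_of_int (pair_product x e)) ^ k e"
      by (simp only: cis_conv_exp[symmetric] Complex.DeMoivre mult.assoc)
    also have "cis (pi / 2 * real_of_int (pair_product x e)) = \<i> * of_int (pair_product x e)"
      using pair_product_cases[OF x that] by (auto simp: complex_eq_iff)
    finally show ?thesis .
  qed
  have "phase n (\<lambda>e. \<phi> e + real (k e) * (pi / 2)) x = phase n \<phi> x +
      (\<Sum>e\<in>row_pairs n. real (k e) * (pi / 2) * real_of_int (pair_product x e))"
    by (simp add: phase_def distrib_right sum.distrib)
  then have "iexp (phase n (\<lambda>e. \<phi> e + real (k e) * (pi / 2)) x) = iexp (phase n \<phi> x) *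
      (\<Prod>e\<in>row_pairs n. iexp (real (k e) * (pi / 2) * real_of_int (pair_product x e)))"
    by (simp only: of_real_add distrib_left exp_add of_real_sum sum_distrib_left exp_sum finite_row_pairs)
  also have "(\<Prod>e\<in>row_pairs n. iexp (real (k e) * (pi / 2) * real_of_int (pair_product x e))) =
      (\<Prod>e\<in>row_pairs n. (\<i> * of_int (pair_product x e)) ^ k e)"
    by (intro prod.cong refl quarter)
  also have "\<dots> = \<i> ^ (\<Sum>e\<in>row_pairs n. k e) * of_int (pair_character n k x)"
    by (simp add: pair_character_def power_mult_distrib prod.distrib power_sum)
  finally show ?thesis by simp
qed

lemma char_fun_quarter_shift:
  "char_fun n (\<lambda>e. \<phi> e + real (k e) * (pi / 2)) =
     \<i> ^ (\<Sum>e\<in>row_pairs n. k e) *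
       ((\<Sum>x\<in>sign_vectors n. of_int (pair_character n k x) * iexp (phase n \<phi> x)) / 2 ^ n)"
proof -
  have "(\<Sum>x\<in>sign_vectors n. iexp (phase n (\<lambda>e. \<phi> e + real (k e) * (pi / 2)) x)) =
      (\<Sum>x\<in>sign_vectors n. \<i> ^ (\<Sum>e\<in>row_pairs n. k e) *
        (of_int (pair_character n k x) * iexp (phase n \<phi> x)))"
    by (intro sum.cong refl) (simp only: iexp_phase_quarter_shift mult.assoc)
  then show ?thesis
    by (simp only: char_fun_def sum_distrib_left[symmetric] times_divide_eq_right)
qed

section \<open>The Gaussian limit\<close>


text \<open>
  On the unit disc the \<open>m\<close>-th power has Lipschitz constant \<open>m\<close>, so an error of order
  \<open>m\<^bsup>-3/2\<^esup>\<close> in the base disappears in the limit.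
\<close>
lemma power_tendsto_exp_of_quadratic_approx:
  fixes z :: "nat \<Rightarrow> complex"
  assumes s: "0 \<le> s" and z: "\<And>m. cmod (z m) \<le> 1"
    and approx: "\<And>m. m > 0 \<Longrightarrow> cmod (z m - of_real (1 + (- s / 2) / real m)) \<le> C / (real m * sqrt (real m))"
  shows "(\<lambda>m. z m ^ m) \<longlonglongrightarrow> of_real (exp (- s / 2))"
proof -
  \<comment> \<open>From here on \<open>1 - s / (2m)\<close> lies in \<open>[-1, 1]\<close>, as the Lipschitz estimate requires.\<close>
  have "eventually (\<lambda>m. m > 0 \<and> s \<le> 4 * real m) sequentially"
    by (intro eventually_conj eventually_gt_at_top eventually_sequentiallyI[of "nat \<lceil>s\<rceil>"]) linarith
  then have "eventually (\<lambda>m. cmod (z m ^ m - of_real ((1 + (- s / 2) / real m) ^ m)) \<le> C / sqrt (real m))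
      sequentially"
  proof eventually_elim
    case (elim m)
    then have m: "m > 0" "real m > 0" by auto
    have "\<bar>1 + (- s / 2) / real m\<bar> \<le> 1"
      using elim s m(2) by (simp add: abs_le_iff field_simps)
    then have "cmod (of_real (1 + (- s / 2) / real m)) \<le> 1"
      by (simp only: norm_of_real)
    from norm_power_diff[OF z this, of m m]
    have "cmod (z m ^ m - of_real ((1 + (- s / 2) / real m) ^ m))
        \<le> real m * cmod (z m - of_real (1 + (- s / 2) / real m))"
      by (simp only: of_real_power)
    also have "\<dots> \<le> real m * (C / (real m * sqrt (real m)))"
      by (intro mult_left_mono approx m) simp
    also have "\<dots> = C / sqrt (real m)"
      using m by simp
    finally show ?case .
  qed
  moreover have "(\<lambda>m. C / sqrt (real m)) \<longlonglongrightarrow> 0"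
    by real_asymp
  ultimately have "(\<lambda>m. z m ^ m - of_real ((1 + (- s / 2) / real m) ^ m)) \<longlonglongrightarrow> 0"
    by (rule Lim_null_comparison)
  moreover have "(\<lambda>m. of_real ((1 + (- s / 2) / real m) ^ m) :: complex) \<longlonglongrightarrow> of_real (exp (- s / 2))"
    by (intro tendsto_of_real tendsto_exp_limit_sequentially)
  ultimately show ?thesis
    by (rule Lim_transform[rotated])
qed

lemma sum_phase: "(\<Sum>x\<in>sign_vectors n. phase n \<theta> x) = 0"
proof -
  have "(\<Sum>x\<in>sign_vectors n. phase n \<theta> x) =
      (\<Sum>e\<in>row_pairs n. \<theta> e * (\<Sum>x\<in>sign_vectors n. real_of_int (pair_product x e)))"
    unfolding phase_def sum_distrib_left by (rule sum.swap)
  also have "\<dots> = 0"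
    by (simp add: sum_pair_product del: of_int_sum)
  finally show ?thesis .
qed

lemma sum_phase_square:
  "(\<Sum>x\<in>sign_vectors n. (phase n \<theta> x)\<^sup>2) = 2 ^ n * (\<Sum>e\<in>row_pairs n. (\<theta> e)\<^sup>2)"
proof -
  have "(\<Sum>x\<in>sign_vectors n. (phase n \<theta> x)\<^sup>2) =
      (\<Sum>x\<in>sign_vectors n. \<Sum>e\<in>row_pairs n. \<Sum>f\<in>row_pairs n.
         \<theta> e * \<theta> f * (real_of_int (pair_product x e) * real_of_int (pair_product x f)))"
    by (simp add: phase_def power2_eq_square sum_product mult_ac)
  also have "\<dots> = (\<Sum>e\<in>row_pairs n. \<Sum>f\<in>row_pairs n. \<theta> e * \<theta> f *
         (\<Sum>x\<in>sign_vectors n. real_of_int (pair_product x e) * real_of_int (pair_product x f)))"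
    unfolding sum_distrib_left
    by (subst sum.swap) (intro sum.cong refl sum.swap)
  also have "\<dots> = (\<Sum>e\<in>row_pairs n. \<Sum>f\<in>row_pairs n. if e = f then \<theta> e * \<theta> f * 2 ^ n else 0)"
    by (intro sum.cong refl) (simp add: sum_pair_product_mult)
  also have "\<dots> = 2 ^ n * (\<Sum>e\<in>row_pairs n. (\<theta> e)\<^sup>2)"
    by (simp add: sum_distrib_left power2_eq_square mult_ac)
  finally show ?thesis .
qed

lemma phase_divide: "phase n (\<lambda>e. \<theta> e / c) x = phase n \<theta> x / c"
  by (simp add: phase_def sum_divide_distrib)

text \<open>
  The second-order Taylor polynomial of the exponential is averaged exactly with the first two
  moments of the phase (\<open>sum_phase\<close> and \<open>sum_phase_square\<close>), and the cubic remainder is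
  \<open>O(m\<^bsup>-3/2\<^esup>)\<close>.
\<close>
lemma char_fun_power_tendsto:
  "(\<lambda>m. char_fun n (\<lambda>e. \<theta> e / sqrt (real m)) ^ m)
     \<longlonglongrightarrow> of_real (exp (- (\<Sum>e\<in>row_pairs n. (\<theta> e)\<^sup>2) / 2))"
proof (rule power_tendsto_exp_of_quadratic_approx)
  let ?V = "sign_vectors n" and ?Y = "phase n \<theta>"
  let ?s = "\<Sum>e\<in>row_pairs n. (\<theta> e)\<^sup>2"
  fix m :: nat assume m: "m > 0"
  let ?q = "\<lambda>y::real. 1 + \<i> * of_real y - of_real (y\<^sup>2 / 2) :: complex"
  have taylor: "cmod (iexp y - ?q y) \<le> \<bar>y\<bar> ^ 3 / 6" for y
    using iexp_approx1[of y 2]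
    by (simp add: numeral_2_eq_2 numeral_3_eq_3 algebra_simps)
  have "(\<Sum>x\<in>?V. ?q (?Y x / sqrt m)) = of_nat (card ?V) + \<i> * of_real ((\<Sum>x\<in>?V. ?Y x) / sqrt m)
      - of_real ((\<Sum>x\<in>?V. (?Y x)\<^sup>2) / (2 * real m))"
    by (simp add: sum.distrib sum_subtractf power_divide sum_divide_distrib sum_distrib_left mult.commute)
  also have "\<dots> = 2 ^ n * of_real (1 + (- ?s / 2) / real m)"
    by (simp add: sum_phase sum_phase_square card_sign_vectors algebra_simps)
  finally have mean: "(\<Sum>x\<in>?V. ?q (?Y x / sqrt m)) = 2 ^ n * of_real (1 + (- ?s / 2) / real m)" .
  have "char_fun n (\<lambda>e. \<theta> e / sqrt m) - of_real (1 + (- ?s / 2) / real m) =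
      (\<Sum>x\<in>?V. iexp (?Y x / sqrt m) - ?q (?Y x / sqrt m)) / 2 ^ n"
    unfolding sum_subtractf[of _ "\<lambda>x. ?q (?Y x / sqrt m)"] mean
    by (simp add: char_fun_def phase_divide diff_divide_distrib)
  also have "cmod \<dots> \<le> (\<Sum>x\<in>?V. \<bar>?Y x / sqrt m\<bar> ^ 3 / 6) / 2 ^ n"
    unfolding norm_divide norm_power norm_numeral
    by (intro divide_right_mono sum_norm_le taylor) simp
  also have "\<dots> = ((\<Sum>x\<in>?V. \<bar>?Y x\<bar> ^ 3 / 6) / 2 ^ n) / (real m * sqrt m)"
    by (simp add: power_divide abs_divide sum_divide_distrib power3_eq_cube mult_ac)
  finally show "cmod (char_fun n (\<lambda>e. \<theta> e / sqrt m) - of_real (1 + (- ?s / 2) / real m))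
      \<le> ((\<Sum>x\<in>?V. \<bar>?Y x\<bar> ^ 3 / 6) / 2 ^ n) / (real m * sqrt m)" .
qed (simp_all add: sum_nonneg cmod_char_fun_le_1)

section \<open>Fourier inversion on a torus cut into small cubes\<close>

lemma integrable_indicator_iexp_affine:
  "integrable lborel (\<lambda>\<theta>. indicator {a..b::real} \<theta> *\<^sub>R iexp ((\<theta> / R + c) * s))"
proof -
  have "continuous_on {a..b} (\<lambda>\<theta>. iexp ((\<theta> / R + c) * s))"
    unfolding divide_inverse by (intro continuous_intros)
  then show ?thesis
    using borel_integrable_atLeastAtMost' unfolding set_integrable_def by blast
qed

text \<open>
  The four intervals of length \<open>\<pi>/2\<close> around \<open>0\<close>, \<open>\<pi>/2\<close>, \<open>\<pi>\<close> and \<open>3\<pi>/2\<close> form a full period, so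
  this is Fourier inversion for an integer, stretched by \<open>R\<close>. With \<open>w = e\<^bsup>i\<pi>s/2\<^esup>\<close> the sum is
  \<open>1 + w + w\<^sup>2 + w\<^sup>3\<close> times the integral over the first interval: the former vanishes unless
  \<open>4\<close> divides \<open>s\<close>, and then the latter vanishes unless \<open>s = 0\<close>.
\<close>
lemma sum_quarter_interval_integrals:
  fixes s :: int and R :: real
  assumes R: "R > 0"
  shows "(\<Sum>k<4::nat. \<integral>\<theta>. indicator {- (pi / 4 * R)..pi / 4 * R} \<theta> *\<^sub>R
            iexp ((\<theta> / R + real k * (pi / 2)) * of_int s) \<partial>lborel) = (if s = 0 then of_real (2 * pi * R) else 0)"
proof -
  define b where "b = pi / 4 * R"
  have b: "0 \<le> b" using R by (simp add: b_def)
  define I where "I = (\<integral>\<theta>. indicator {- b..b} \<theta> *\<^sub>R iexp (\<theta> / R * of_int s) \<partial>lborel)"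
  define w where "w = cis (pi / 2 * of_int s)"
  have shifted: "(\<integral>\<theta>. indicator {- b..b} \<theta> *\<^sub>R iexp ((\<theta> / R + real k * (pi / 2)) * of_int s) \<partial>lborel) = w ^ k * I"
    for k :: nat
  proof -
    have "iexp ((\<theta> / R + real k * (pi / 2)) * of_int s) = w ^ k * iexp (\<theta> / R * of_int s)" for \<theta>
    proof -
      have "w ^ k * iexp (\<theta> / R * of_int s) = cis (real k * (pi / 2 * of_int s) + \<theta> / R * of_int s)"
        by (simp only: w_def Complex.DeMoivre cis_conv_exp[symmetric] cis_mult)
      also have "real k * (pi / 2 * of_int s) + \<theta> / R * of_int s = (\<theta> / R + real k * (pi / 2)) * of_int s"
        by (simp add: algebra_simps)
      finally show ?thesis by (simp only: cis_conv_exp)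
    qed
    then have "indicator {- b..b} \<theta> *\<^sub>R iexp ((\<theta> / R + real k * (pi / 2)) * of_int s) =
        w ^ k * (indicator {- b..b} \<theta> *\<^sub>R iexp (\<theta> / R * of_int s))" for \<theta>
      by (simp only: mult_scaleR_right)
    then show ?thesis
      by (simp only: I_def integral_mult_right_zero)
  qed
  have sum: "(\<Sum>k<4. w ^ k) * I = (if s = 0 then of_real (2 * pi * R) else 0)"
  proof (cases "w = 1")
    case False
    have "w ^ 4 = cis (2 * pi * of_int s)"
      by (simp only: w_def Complex.DeMoivre) (simp add: mult_ac)
    also have "\<dots> = 1"
      by (rule cis_multiple_2pi) simp
    finally have "(\<Sum>k<4. w ^ k) = 0"
      using geometric_sum[OF False, of 4] by simp
    moreover have "s \<noteq> 0"
      using False by (auto simp: w_def)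
    ultimately show ?thesis by simp
  next
    case True
    show ?thesis
    proof (cases "s = 0")
      case True
      have "I = of_real (2 * b)"
        using b by (simp add: I_def True scaleR_conv_of_real)
      then show ?thesis
        using \<open>w = 1\<close> True by (simp add: b_def mult_ac)
    next
      case False
      \<comment> \<open>Now \<open>4\<close> divides \<open>s\<close>, so the interval holds a whole number of periods.\<close>
      have "cos (pi / 2 * of_int s) = 1"
        using arg_cong[OF True, of Re] by (simp add: w_def)
      then obtain j :: int where "pi / 2 * of_int s = of_int j * (2 * pi)"
        by (auto simp: cos_one_2pi_int mult.assoc)
      then have s: "real_of_int s = 4 * real_of_int j"
        by simp
      define c where "c = real_of_int s / R"
      have "j \<noteq> 0" using False s by auto
      then have c: "c \<noteq> 0" "b * c = pi * real_of_int j"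
        using R by (simp_all add: c_def b_def s)
      have "I = (\<integral>\<theta>. indicator {- b..b} \<theta> *\<^sub>R iexp (\<theta> * c) \<partial>lborel)"
        by (simp add: I_def c_def)
      also have "\<dots> = iexp (b * c) / (\<i> * c) - iexp (- b * c) / (\<i> * c)"
      proof (rule integral_FTC_atLeastAtMost)
        show "((\<lambda>\<theta>. iexp (\<theta> * c) / (\<i> * c)) has_vector_derivative iexp (x * c)) (at x within {- b..b})" for x
          using c(1) by (auto intro!: derivative_eq_intros has_vector_derivative_real_field simp: has_vector_derivative_complex_iff Re_exp Im_exp Re_divide Im_divide power2_eq_square power4_eq_xxxx)
        show "continuous_on {- b..b} (\<lambda>x. iexp (x * c))"
          by (intro continuous_intros)
      qed (use b in simp)
      also have "iexp (b * c) = iexp (- b * c)"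
      proof -
        have "cis (pi * of_int j) = cis (- (pi * of_int j))"
          by (simp add: complex_eq_iff)
        then show ?thesis
          using c(2) by (simp only: cis_conv_exp[symmetric] mult_minus_left)
      qed
      finally show ?thesis using False by simp
    qed
  qed
  have "(\<Sum>k<4::nat. \<integral>\<theta>. indicator {- b..b} \<theta> *\<^sub>R
            iexp ((\<theta> / R + real k * (pi / 2)) * of_int s) \<partial>lborel) = (\<Sum>k<4. w ^ k) * I"
    by (simp only: shifted sum_distrib_right)
  then show ?thesis
    unfolding sum b_def .
qed

text \<open>
  The characteristic function of \<open>m\<close> independent steps, written out as a sum over walks \<open>c\<close> and a
  product over the coordinates of the end point.
\<close>
lemma char_fun_power_eq:
  "(2 ^ n * char_fun n \<theta>) ^ m =
     (\<Sum>c\<in>{..<m} \<rightarrow>\<^sub>E sign_vectors n.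
        \<Prod>e\<in>row_pairs n. iexp (\<theta> e * of_int (\<Sum>l<m. pair_product (c l) e)))"
proof -
  have "(2 ^ n * char_fun n \<theta>) ^ m = (\<Prod>l<m. \<Sum>x\<in>sign_vectors n. iexp (phase n \<theta> x))"
    by (simp add: char_fun_def)
  also have "\<dots> = (\<Sum>c\<in>{..<m} \<rightarrow>\<^sub>E sign_vectors n. \<Prod>l<m. iexp (phase n \<theta> (c l)))"
    by (rule prod_sum_PiE) auto
  also have "\<dots> = (\<Sum>c\<in>{..<m} \<rightarrow>\<^sub>E sign_vectors n.
        \<Prod>e\<in>row_pairs n. iexp (\<theta> e * of_int (\<Sum>l<m. pair_product (c l) e)))"
  proof (intro sum.cong refl)
    fix c
    have "(\<Sum>l<m. phase n \<theta> (c l)) = (\<Sum>e\<in>row_pairs n. \<theta> e * of_int (\<Sum>l<m. pair_product (c l) e))"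
      unfolding phase_def of_int_sum sum_distrib_left by (rule sum.swap)
    then have "iexp (\<Sum>l<m. phase n \<theta> (c l)) =
        iexp (\<Sum>e\<in>row_pairs n. \<theta> e * of_int (\<Sum>l<m. pair_product (c l) e))"
      by (simp only:)
    then show "(\<Prod>l<m. iexp (phase n \<theta> (c l))) =
        (\<Prod>e\<in>row_pairs n. iexp (\<theta> e * of_int (\<Sum>l<m. pair_product (c l) e)))"
      by (simp only: of_real_sum sum_distrib_left exp_sum finite_row_pairs finite_lessThan)
  qed
  finally show ?thesis .
qed

text \<open>
  Each coordinate of the end point of a walk is tested for zero by the one-dimensional inversion
  formula. Multiplying out, the choice of one interval per coordinate becomes the choice of a cube \<open>k\<close>, and
  the product of one-dimensional integrals becomes an integral over that cube.
\<close>
lemma num_partial_hadamard_fourier: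
  assumes R: "R > 0"
  defines "J \<equiv> {- (pi / 4 * R)..pi / 4 * R}"
  shows "of_nat (num_partial_hadamard n m) * of_real (2 * pi * R) ^ (n choose 2) =
    (\<Sum>k\<in>row_pairs n \<rightarrow>\<^sub>E {..<4}. \<integral>\<theta>. (\<Prod>e\<in>row_pairs n. indicator J (\<theta> e)) *\<^sub>R
       (2 ^ n * char_fun n (\<lambda>e. \<theta> e / R + real (k e) * (pi / 2))) ^ m \<partial>Pi\<^sub>M (row_pairs n) (\<lambda>_. lborel))"
proof -
  interpret product_sigma_finite "\<lambda>_::nat \<times> nat. lborel :: real measure"
    by (rule product_sigma_finite.intro) (rule lborel.sigma_finite_measure_axioms)
  let ?E = "row_pairs n" and ?C = "{..<m} \<rightarrow>\<^sub>E sign_vectors n"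
  let ?K = "?E \<rightarrow>\<^sub>E {..<4::nat}"
  define S where "S c e = (\<Sum>l<m. pair_product (c l) e)" for c e
  define g where "g c k e \<theta> = indicator J \<theta> *\<^sub>R iexp ((\<theta> / R + real (k e) * (pi / 2)) * of_int (S c e))"
    for c :: "nat \<Rightarrow> nat \<Rightarrow> int" and k e \<theta>
  have finC: "finite ?C" by (intro finite_PiE) auto
  have int_g: "integrable lborel (g c k e)" for c k e
    unfolding g_def J_def by (rule integrable_indicator_iexp_affine)
  have cube: "(\<integral>\<theta>. (\<Prod>e\<in>?E. indicator J (\<theta> e)) *\<^sub>R
       (2 ^ n * char_fun n (\<lambda>e. \<theta> e / R + real (k e) * (pi / 2))) ^ m \<partial>Pi\<^sub>M ?E (\<lambda>_. lborel)) =
     (\<Sum>c\<in>?C. \<Prod>e\<in>?E. integral\<^sup>L lborel (g c k e))" for k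
  proof -
    have "(\<Prod>e\<in>?E. indicator J (\<theta> e)) *\<^sub>R
         (2 ^ n * char_fun n (\<lambda>e. \<theta> e / R + real (k e) * (pi / 2))) ^ m = (\<Sum>c\<in>?C. \<Prod>e\<in>?E. g c k e (\<theta> e))" for \<theta>
      unfolding char_fun_power_eq g_def scaleR_sum_right S_def
      by (intro sum.cong refl) (simp only: scaleR_conv_of_real of_real_prod prod.distrib)
    then have "(\<integral>\<theta>. (\<Prod>e\<in>?E. indicator J (\<theta> e)) *\<^sub>R
       (2 ^ n * char_fun n (\<lambda>e. \<theta> e / R + real (k e) * (pi / 2))) ^ m \<partial>Pi\<^sub>M ?E (\<lambda>_. lborel)) =
      (\<integral>\<theta>. (\<Sum>c\<in>?C. \<Prod>e\<in>?E. g c k e (\<theta> e)) \<partial>Pi\<^sub>M ?E (\<lambda>_. lborel))"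
      by (simp only:)
    also have "\<dots> = (\<Sum>c\<in>?C. \<integral>\<theta>. (\<Prod>e\<in>?E. g c k e (\<theta> e)) \<partial>Pi\<^sub>M ?E (\<lambda>_. lborel))"
      by (intro Bochner_Integration.integral_sum product_integrable_prod int_g finite_row_pairs)
    also have "\<dots> = (\<Sum>c\<in>?C. \<Prod>e\<in>?E. integral\<^sup>L lborel (g c k e))"
      by (intro sum.cong refl product_integral_prod int_g finite_row_pairs)
    finally show ?thesis .
  qed
  have "(\<Sum>k\<in>?K. \<Sum>c\<in>?C. \<Prod>e\<in>?E. integral\<^sup>L lborel (g c k e)) =
      (\<Sum>c\<in>?C. \<Sum>k\<in>?K. \<Prod>e\<in>?E. integral\<^sup>L lborel (g c k e))"
    by (rule sum.swap)
  also have "\<dots> = (\<Sum>c\<in>?C. \<Prod>e\<in>?E. \<Sum>j<4. integral\<^sup>L lborel (g c (\<lambda>_. j) e))"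
    unfolding g_def by (intro sum.cong refl prod_sum_PiE[symmetric]) auto
  also have "\<dots> = (\<Sum>c\<in>?C. \<Prod>e\<in>?E. if S c e = 0 then of_real (2 * pi * R) else 0)"
    unfolding g_def J_def by (intro sum.cong prod.cong refl sum_quarter_interval_integrals R)
  also have "\<dots> = (\<Sum>c\<in>?C. if \<forall>e\<in>?E. S c e = 0 then of_real (2 * pi * R) ^ (n choose 2) else 0)"
  proof (intro sum.cong refl)
    fix c
    show "(\<Prod>e\<in>?E. if S c e = 0 then of_real (2 * pi * R) else 0) =
        (if \<forall>e\<in>?E. S c e = 0 then of_real (2 * pi * R) ^ (n choose 2) else (0::complex))"
    proof (cases "\<forall>e\<in>?E. S c e = 0")
      case True
      then have "(\<Prod>e\<in>?E. if S c e = 0 then of_real (2 * pi * R) else 0) =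
          (\<Prod>e\<in>?E. of_real (2 * pi * R) :: complex)"
        by (intro prod.cong) auto
      with True show ?thesis by (simp add: card_row_pairs)
    next
      case False
      then show ?thesis by (auto simp: prod_zero_iff)
    qed
  qed
  also have "\<dots> = of_nat (card {c \<in> ?C. \<forall>e\<in>?E. S c e = 0}) * of_real (2 * pi * R) ^ (n choose 2)"
    using finC by (simp add: sum.If_cases Int_def)
  finally show ?thesis
    by (simp only: cube num_partial_hadamard_eq_card_closed_walks S_def)
qed

section \<open>Dominated convergence on each cube\<close>

lemma integrable_exp_neg_square:
  fixes c :: real
  assumes "c > 0"
  shows "integrable lborel (\<lambda>x. exp (- x\<^sup>2 / c))"
proof -
  have "integrable lborel (\<lambda>x. sqrt (2 * pi * (sqrt (c / 2))\<^sup>2) * normal_density 0 (sqrt (c / 2)) x)"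
    by (intro integrable_mult_right integrable_normal_density) (use assms in simp)
  also have "(\<lambda>x. sqrt (2 * pi * (sqrt (c / 2))\<^sup>2) * normal_density 0 (sqrt (c / 2)) x) = (\<lambda>x. exp (- x\<^sup>2 / c))"
    using assms by (simp add: normal_density_def fun_eq_iff)
  finally show ?thesis .
qed

lemma integral_exp_neg_half_square: "(\<integral>x. exp (- x\<^sup>2 / 2) \<partial>lborel) = sqrt (2 * pi)"
proof -
  have "(\<integral>x. exp (- x\<^sup>2 / 2) \<partial>lborel) = (\<integral>x. sqrt (2 * pi) * std_normal_density x \<partial>lborel)"
    by (simp add: std_normal_density_def)
  also have "\<dots> = sqrt (2 * pi)"
    by (simp only: integral_mult_right_zero) simp
  finally show ?thesis .
qed

text \<open>
  The integrand of the cube around \<open>k\<pi>/2\<close> in coordinates centred there and stretched by \<open>\<surd>m\<close>; it is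
  extended by zero to the whole space so that the domain is the same for all \<open>m\<close>.
\<close>
definition rescaled_integrand ::
    "nat \<Rightarrow> (nat \<times> nat \<Rightarrow> nat) \<Rightarrow> nat \<Rightarrow> (nat \<times> nat \<Rightarrow> real) \<Rightarrow> complex" where
  "rescaled_integrand n k m \<theta> =
     (\<Prod>e\<in>row_pairs n. indicator {- (pi / 4 * sqrt (real m))..pi / 4 * sqrt (real m)} (\<theta> e)) *\<^sub>R
       char_fun n (\<lambda>e. \<theta> e / sqrt (real m) + real (k e) * (pi / 2)) ^ m"

lemma measurable_rescaled_integrand:
  "rescaled_integrand n k m \<in> borel_measurable (Pi\<^sub>M (row_pairs n) (\<lambda>_. lborel))"
  unfolding rescaled_integrand_def[abs_def] char_fun_def phase_def
  by measurable

lemma cmod_rescaled_integrand_le: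
  assumes n: "n \<ge> 2" and m: "m > 0"
  shows "cmod (rescaled_integrand n k m \<theta>) \<le> (\<Prod>e\<in>row_pairs n. exp (- (\<theta> e)\<^sup>2 / (3 * real (n choose 2))))"
proof (cases "\<forall>e\<in>row_pairs n. \<bar>\<theta> e\<bar> \<le> pi / 4 * sqrt (real m)")
  case True
  let ?E = "row_pairs n" and ?d = "3 * real (n choose 2)"
  have "cmod (rescaled_integrand n k m \<theta>) \<le>
      cmod (char_fun n (\<lambda>e. \<theta> e / sqrt (real m) + real (k e) * (pi / 2))) ^ m"
  proof -
    have "(\<Prod>e\<in>?E. indicator {- (pi / 4 * sqrt (real m))..pi / 4 * sqrt (real m)} (\<theta> e)) = (1::real)"
      using True by (intro prod.neutral) (auto simp: indicator_def abs_le_iff)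
    then show ?thesis by (simp only: rescaled_integrand_def norm_power scaleR_one)
  qed
  also have "\<dots> \<le> exp (- (\<Sum>e\<in>?E. (\<theta> e / sqrt (real m))\<^sup>2) / ?d) ^ m"
    using True m by (intro power_mono cmod_char_fun_gaussian_bound n) (auto simp: field_simps)
  also have "\<dots> = exp (\<Sum>e\<in>?E. - (\<theta> e)\<^sup>2 / ?d)"
    using m by (simp add: power_divide sum_negf flip: exp_of_nat_mult sum_divide_distrib)
  also have "\<dots> = (\<Prod>e\<in>?E. exp (- (\<theta> e)\<^sup>2 / ?d))"
    by (rule exp_sum) simp
  finally show ?thesis .
next
  case False
  then obtain e where e: "e \<in> row_pairs n" "\<not> \<bar>\<theta> e\<bar> \<le> pi / 4 * sqrt (real m)"
    by blast
  then have "\<theta> e \<notin> {- (pi / 4 * sqrt (real m))..pi / 4 * sqrt (real m)}"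
    unfolding atLeastAtMost_iff by linarith
  with e(1) have "(\<Prod>e\<in>row_pairs n. indicator {- (pi / 4 * sqrt (real m))..pi / 4 * sqrt (real m)} (\<theta> e)) = (0::real)"
    by (intro prod_zero) (auto simp: indicator_def)
  then have "rescaled_integrand n k m \<theta> = 0"
    by (simp only: rescaled_integrand_def scaleR_zero_left)
  then show ?thesis by (simp add: prod_nonneg)
qed

lemma eventually_cube_indicator_eq_1:
  "eventually (\<lambda>m. (\<Prod>e\<in>row_pairs n. indicator {- (pi / 4 * sqrt (real m))..pi / 4 * sqrt (real m)} (\<theta> e)) = (1::real))
     sequentially"
proof -
  have "eventually (\<lambda>m. \<bar>\<theta> e\<bar> \<le> pi / 4 * sqrt (real m)) sequentially" for e
  proof -
    have "filterlim (\<lambda>m. pi / 4 * sqrt (real m)) at_top sequentially"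
      by real_asymp
    then show ?thesis by (simp add: filterlim_at_top)
  qed
  then have "eventually (\<lambda>m. \<forall>e\<in>row_pairs n. \<bar>\<theta> e\<bar> \<le> pi / 4 * sqrt (real m)) sequentially"
    by (intro eventually_ball_finite) auto
  then show ?thesis
  proof eventually_elim
    case (elim m)
    show ?case
    proof (intro prod.neutral ballI)
      fix e assume "e \<in> row_pairs n"
      with elim have "\<bar>\<theta> e\<bar> \<le> pi / 4 * sqrt (real m)" by blast
      then have "\<theta> e \<in> {- (pi / 4 * sqrt (real m))..pi / 4 * sqrt (real m)}"
        unfolding atLeastAtMost_iff by linarith
      then show "indicator {- (pi / 4 * sqrt (real m))..pi / 4 * sqrt (real m)} (\<theta> e) = (1::real)"
        by (rule indicator_simps)
    qed
  qed
qed

text \<open>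
  The arguments approach the centre \<open>k\<pi>/2\<close>, where the characteristic function is the average of a
  nontrivial character.
\<close>
lemma char_fun_nontrivial_tendsto_0:
  assumes k: "k \<in> row_pairs n \<rightarrow>\<^sub>E {..<4}" "k \<notin> trivial_exponents n"
  shows "(\<lambda>m. char_fun n (\<lambda>e. \<theta> e / sqrt (real m) + real (k e) * (pi / 2))) \<longlonglongrightarrow> 0"
proof -
  have "(\<lambda>m. iexp (c / sqrt (real m))) \<longlonglongrightarrow> iexp 0" for c
  proof (rule isCont_tendsto_compose[OF isCont_iexp])
    show "(\<lambda>m. c / sqrt (real m)) \<longlonglongrightarrow> 0" by real_asymp
  qed
  then have "(\<lambda>m. (\<Sum>x\<in>sign_vectors n. of_int (pair_character n k x) * iexp (phase n \<theta> x / sqrt (real m))) / 2 ^ n)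
      \<longlonglongrightarrow> (\<Sum>x\<in>sign_vectors n. of_int (pair_character n k x) * iexp 0) / 2 ^ n"
    by (intro tendsto_divide tendsto_sum tendsto_mult tendsto_const) auto
  moreover have "(\<Sum>x\<in>sign_vectors n. of_int (pair_character n k x) * iexp 0) = 0"
  proof -
    have "(\<Sum>x\<in>sign_vectors n. pair_character n k x) = 0"
      using k by (auto simp: sum_pair_character trivial_exponents_def)
    then have "complex_of_int (\<Sum>x\<in>sign_vectors n. pair_character n k x) = of_int 0"
      by (simp only:)
    then show ?thesis by simp
  qed
  ultimately have "(\<lambda>m. \<i> ^ (\<Sum>e\<in>row_pairs n. k e) *
      ((\<Sum>x\<in>sign_vectors n. of_int (pair_character n k x) * iexp (phase n \<theta> x / sqrt (real m))) / 2 ^ n)) \<longlonglongrightarrow> 0"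
    by (intro tendsto_mult_right_zero) simp
  then show ?thesis
    by (simp only: char_fun_quarter_shift phase_divide)
qed

text \<open>
  The shift only contributes a power of \<open>\<i>\<close>. This is where it matters that the number of columns is a
  multiple of four.
\<close>
lemma char_fun_trivial_shift_power:
  assumes "k \<in> trivial_exponents n"
  shows "char_fun n (\<lambda>e. \<phi> e + real (k e) * (pi / 2)) ^ (4 * t) = char_fun n \<phi> ^ (4 * t)"
proof -
  have "char_fun n (\<lambda>e. \<phi> e + real (k e) * (pi / 2)) = \<i> ^ (\<Sum>e\<in>row_pairs n. k e) * char_fun n \<phi>"
  proof -
    have "(\<Sum>x\<in>sign_vectors n. of_int (pair_character n k x) * iexp (phase n \<phi> x)) =
        (\<Sum>x\<in>sign_vectors n. iexp (phase n \<phi> x))"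
      using assms by (intro sum.cong) (auto simp: trivial_exponents_def)
    then show ?thesis
      by (simp only: char_fun_quarter_shift) (simp only: char_fun_def)
  qed
  moreover have "(\<i> ^ (\<Sum>e\<in>row_pairs n. k e)) ^ (4 * t) = 1"
  proof -
    have "(\<i> ^ (\<Sum>e\<in>row_pairs n. k e)) ^ (4 * t) = (\<i> ^ 4) ^ ((\<Sum>e\<in>row_pairs n. k e) * t)"
      by (simp only: power_mult[symmetric] mult_ac)
    also have "\<i> ^ 4 = 1" by (simp add: eval_nat_numeral)
    finally show ?thesis by simp
  qed
  ultimately show ?thesis by (simp only: power_mult_distrib mult_1_left)
qed

lemma rescaled_integrand_tendsto:
  assumes k: "k \<in> row_pairs n \<rightarrow>\<^sub>E {..<4}"
  shows "(\<lambda>t. rescaled_integrand n k (4 * t) \<theta>) \<longlonglongrightarrow>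
     of_real (of_bool (k \<in> trivial_exponents n) * (\<Prod>e\<in>row_pairs n. exp (- (\<theta> e)\<^sup>2 / 2)))"
proof -
  let ?\<psi> = "\<lambda>m. char_fun n (\<lambda>e. \<theta> e / sqrt (real m) + real (k e) * (pi / 2)) ^ m"
  have sub: "filterlim (\<lambda>t::nat. 4 * t) sequentially sequentially"
    by (rule filterlim_subseq) (simp add: strict_mono_def)
  have "(\<lambda>t. ?\<psi> (4 * t)) \<longlonglongrightarrow>
     of_real (of_bool (k \<in> trivial_exponents n) * (\<Prod>e\<in>row_pairs n. exp (- (\<theta> e)\<^sup>2 / 2)))"
  proof (cases "k \<in> trivial_exponents n")
    case True
    have "(\<lambda>t. char_fun n (\<lambda>e. \<theta> e / sqrt (real (4 * t))) ^ (4 * t)) \<longlonglongrightarrow>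
        of_real (exp (- (\<Sum>e\<in>row_pairs n. (\<theta> e)\<^sup>2) / 2))"
      by (rule filterlim_compose[OF char_fun_power_tendsto sub])
    moreover have "exp (- (\<Sum>e\<in>row_pairs n. (\<theta> e)\<^sup>2) / 2) = (\<Prod>e\<in>row_pairs n. exp (- (\<theta> e)\<^sup>2 / 2))"
      by (simp add: sum_negf flip: exp_sum sum_divide_distrib)
    ultimately show ?thesis
      using True by (simp only: char_fun_trivial_shift_power[OF True]) simp
  next
    case False
    \<comment> \<open>Any bound below \<open>1\<close> would do: its \<open>m\<close>-th power tends to zero.\<close>
    have "eventually (\<lambda>m. cmod (char_fun n (\<lambda>e. \<theta> e / sqrt (real m) + real (k e) * (pi / 2))) < 1 / 2) sequentially"
      using order_tendstoD(2)[OF tendsto_norm[OF char_fun_nontrivial_tendsto_0[OF k False, of \<theta>]], of "1/2"] by simp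
    then have "eventually (\<lambda>m. norm (?\<psi> m) \<le> (1 / 2) ^ m) sequentially"
      by eventually_elim (auto simp: norm_power intro!: power_mono)
    then have "?\<psi> \<longlonglongrightarrow> 0"
      by (rule Lim_null_comparison) (rule LIMSEQ_realpow_zero, simp_all)
    from filterlim_compose[OF this sub] show ?thesis
      using False by simp
  qed
  moreover have "eventually (\<lambda>t. ?\<psi> (4 * t) = rescaled_integrand n k (4 * t) \<theta>) sequentially"
    using filterlim_iff[THEN iffD1, OF sub, rule_format, OF eventually_cube_indicator_eq_1[where n = n and \<theta> = \<theta>]]
    by eventually_elim (simp only: rescaled_integrand_def scaleR_one)
  ultimately show ?thesis
    by (rule Lim_transform_eventually)
qed

text \<open>
  The majorant is valid for a positive number of columns, hence the index \<open>Suc t\<close>.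
\<close>
lemma integral_rescaled_integrand_tendsto:
  assumes n: "n \<ge> 2" and k: "k \<in> row_pairs n \<rightarrow>\<^sub>E {..<4}"
  shows "(\<lambda>t. integral\<^sup>L (Pi\<^sub>M (row_pairs n) (\<lambda>_. lborel)) (rescaled_integrand n k (4 * Suc t)))
     \<longlonglongrightarrow> of_real (of_bool (k \<in> trivial_exponents n) * sqrt (2 * pi) ^ (n choose 2))"
proof -
  interpret product_sigma_finite "\<lambda>_::nat \<times> nat. lborel :: real measure"
    by (rule product_sigma_finite.intro) (rule lborel.sigma_finite_measure_axioms)
  let ?E = "row_pairs n"
  let ?M = "Pi\<^sub>M ?E (\<lambda>_. lborel :: real measure)"
  let ?lim = "\<lambda>\<theta>. complex_of_real (of_bool (k \<in> trivial_exponents n) * (\<Prod>e\<in>?E. exp (- (\<theta> e)\<^sup>2 / 2)))"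
  have "(\<lambda>t. integral\<^sup>L ?M (rescaled_integrand n k (4 * Suc t))) \<longlonglongrightarrow> integral\<^sup>L ?M ?lim"
  proof (rule integral_dominated_convergence)
    show "?lim \<in> borel_measurable ?M"
      by measurable
    show "rescaled_integrand n k (4 * Suc t) \<in> borel_measurable ?M" for t
      by (rule measurable_rescaled_integrand)
    show "integrable ?M (\<lambda>\<theta>. \<Prod>e\<in>?E. exp (- (\<theta> e)\<^sup>2 / (3 * real (n choose 2))))"
      using n by (intro product_integrable_prod integrable_exp_neg_square) (auto simp: zero_less_binomial_iff)
    show "AE \<theta> in ?M. (\<lambda>t. rescaled_integrand n k (4 * Suc t) \<theta>) \<longlonglongrightarrow> ?lim \<theta>"
      by (intro AE_I2 LIMSEQ_Suc rescaled_integrand_tendsto k)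
    show "AE \<theta> in ?M. norm (rescaled_integrand n k (4 * Suc t) \<theta>) \<le>
        (\<Prod>e\<in>?E. exp (- (\<theta> e)\<^sup>2 / (3 * real (n choose 2))))" for t
      by (intro AE_I2 cmod_rescaled_integrand_le n) simp
  qed
  also have "integral\<^sup>L ?M ?lim = of_real (of_bool (k \<in> trivial_exponents n) *
      (\<integral>\<theta>. (\<Prod>e\<in>?E. exp (- (\<theta> e)\<^sup>2 / 2)) \<partial>?M))"
    by (simp only: integral_complex_of_real integral_mult_right_zero)
  also have "(\<integral>\<theta>. (\<Prod>e\<in>?E. exp (- (\<theta> e)\<^sup>2 / 2)) \<partial>?M) = (\<Prod>e\<in>?E. \<integral>x. exp (- x\<^sup>2 / 2) \<partial>lborel)"
    by (intro product_integral_prod integrable_exp_neg_square) simp_all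
  also have "\<dots> = sqrt (2 * pi) ^ (n choose 2)"
    by (simp only: integral_exp_neg_half_square prod_constant card_row_pairs)
  finally show ?thesis .
qed

section \<open>The asymptotic count\<close>

lemma num_partial_hadamard_limit:
  assumes n: "n \<ge> 2"
  shows "(\<lambda>t. real (num_partial_hadamard n (4 * t)) * (2 * pi * sqrt (real (4 * t))) ^ (n choose 2) / 2 ^ (n * (4 * t)))
     \<longlonglongrightarrow> real (card (trivial_exponents n)) * sqrt (2 * pi) ^ (n choose 2)"
proof (rule LIMSEQ_imp_Suc)
  let ?E = "row_pairs n"
  let ?K = "?E \<rightarrow>\<^sub>E {..<4::nat}"
  let ?M = "Pi\<^sub>M ?E (\<lambda>_. lborel :: real measure)"
  have finK: "finite ?K" by (intro finite_PiE) auto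
  have "of_nat (num_partial_hadamard n m) * of_real (2 * pi * sqrt (real m)) ^ (n choose 2) / 2 ^ (n * m) =
      (\<Sum>k\<in>?K. integral\<^sup>L ?M (rescaled_integrand n k m))" if "m > 0" for m
  proof -
    have "of_nat (num_partial_hadamard n m) * of_real (2 * pi * sqrt (real m)) ^ (n choose 2) =
        (\<Sum>k\<in>?K. integral\<^sup>L ?M (\<lambda>\<theta>. 2 ^ (n * m) * rescaled_integrand n k m \<theta>))"
      using that
      by (subst num_partial_hadamard_fourier)
         (simp_all only: rescaled_integrand_def power_mult_distrib power_mult mult_scaleR_right of_nat_0_less_iff real_sqrt_gt_0_iff)
    then show ?thesis
      by (simp only: integral_mult_right_zero sum_distrib_left[symmetric]) simp
  qed
  note eq = this
  have "(\<lambda>t. \<Sum>k\<in>?K. integral\<^sup>L ?M (rescaled_integrand n k (4 * Suc t)))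
      \<longlonglongrightarrow> (\<Sum>k\<in>?K. of_real (of_bool (k \<in> trivial_exponents n) * sqrt (2 * pi) ^ (n choose 2)))"
    by (intro tendsto_sum integral_rescaled_integrand_tendsto n)
  also have "(\<Sum>k\<in>?K. complex_of_real (of_bool (k \<in> trivial_exponents n) * sqrt (2 * pi) ^ (n choose 2))) =
      of_real (real (card (trivial_exponents n)) * sqrt (2 * pi) ^ (n choose 2))"
  proof -
    have "?K \<inter> {k. k \<in> trivial_exponents n} = trivial_exponents n"
      by (auto simp: trivial_exponents_def)
    then have "(\<Sum>k\<in>?K. of_bool (k \<in> trivial_exponents n)) = real (card (trivial_exponents n))"
      using finK by (simp add: of_bool_def sum.If_cases)
    then show ?thesis
      by (simp only: of_real_sum[symmetric] sum_distrib_right[symmetric])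
  qed
  finally have lim: "(\<lambda>t. \<Sum>k\<in>?K. integral\<^sup>L ?M (rescaled_integrand n k (4 * Suc t)))
      \<longlonglongrightarrow> of_real (real (card (trivial_exponents n)) * sqrt (2 * pi) ^ (n choose 2))" .
  have "(\<Sum>k\<in>?K. integral\<^sup>L ?M (rescaled_integrand n k (4 * Suc t))) =
      of_real (real (num_partial_hadamard n (4 * Suc t)) *
        (2 * pi * sqrt (real (4 * Suc t))) ^ (n choose 2) / 2 ^ (n * (4 * Suc t)))" for t
    using eq[of "4 * Suc t"]
    by (simp only: of_real_mult of_real_divide of_real_power of_real_numeral of_real_of_nat_eq) simp
  with lim have "(\<lambda>t. complex_of_real (real (num_partial_hadamard n (4 * Suc t)) *
        (2 * pi * sqrt (real (4 * Suc t))) ^ (n choose 2) / 2 ^ (n * (4 * Suc t))))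
      \<longlonglongrightarrow> of_real (real (card (trivial_exponents n)) * sqrt (2 * pi) ^ (n choose 2))"
    by (simp only:)
  then show "(\<lambda>t. real (num_partial_hadamard n (4 * Suc t)) *
        (2 * pi * sqrt (real (4 * Suc t))) ^ (n choose 2) / 2 ^ (n * (4 * Suc t)))
      \<longlonglongrightarrow> real (card (trivial_exponents n)) * sqrt (2 * pi) ^ (n choose 2)"
    by (simp only: tendsto_of_real_iff)
qed

theorem theorem2:
  fixes n d :: nat
  assumes "n \<ge> 2" and "d = n choose 2"
  shows "(\<lambda>t::nat. real (num_partial_hadamard n (4 * t))) \<sim>[at_top]
    (\<lambda>t. 2 powr (2 * real d - real n + 4 * real n * real t + 1)
          * (8 * pi * real t) powr (- (real d / 2)))"
proof (rule asymp_equivI')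
  let ?g = "\<lambda>t. 2 powr (2 * real d - real n + 4 * real n * real t + 1)
          * (8 * pi * real t) powr (- (real d / 2))"
  define L where "L = real (card (trivial_exponents n)) * sqrt (2 * pi) ^ d"
  have card: "real (card (trivial_exponents n)) = 2 * 4 ^ d / 2 ^ n"
  proof -
    have "real (2 ^ n * card (trivial_exponents n)) = real (2 * 4 ^ d)"
      using assms by (subst card_trivial_exponents) auto
    then show ?thesis by (simp add: field_simps)
  qed
  have L: "L \<noteq> 0"
    by (simp add: L_def card)
  have main_term: "?g t = L * 2 ^ (n * (4 * t)) / (2 * pi * sqrt (real (4 * t))) ^ d" if "t > 0" for t :: nat
  proof -
    have "(8 * pi * real t) powr (- (real d / 2)) = 1 / sqrt (8 * pi * real t) ^ d"
      using that by (simp add: powr_minus powr_half_sqrt_powr powr_realpow real_sqrt_power inverse_eq_divide)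
    also have "sqrt (8 * pi * real t) = 2 * pi * sqrt (real (4 * t)) / sqrt (2 * pi)"
    proof -
      have "2 * pi * sqrt (real (4 * t)) = sqrt (2 * pi) * (sqrt (2 * pi) * sqrt (real (4 * t)))"
        by (simp flip: mult.assoc)
      also have "sqrt (2 * pi) * sqrt (real (4 * t)) = sqrt (8 * pi * real t)"
        by (simp only: real_sqrt_mult[symmetric]) (simp add: mult_ac)
      finally show ?thesis by simp
    qed
    finally have pw: "(8 * pi * real t) powr (- (real d / 2)) =
        sqrt (2 * pi) ^ d / (2 * pi * sqrt (real (4 * t))) ^ d"
      by (simp add: power_divide)
    have "2 powr (2 * real d - real n + 4 * real n * real t + 1) =
        2 powr real (2 * d) / 2 powr real n * 2 powr real (n * (4 * t)) * 2 powr 1"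
    proof -
      have "2 * real d - real n + 4 * real n * real t + 1 = real (2 * d) - real n + real (n * (4 * t)) + 1"
        by simp
      then show ?thesis by (simp only: powr_add powr_diff)
    qed
    also have "\<dots> = (2 * 4 ^ d / 2 ^ n) * 2 ^ (n * (4 * t))"
      by (simp only: powr_realpow zero_less_numeral) (simp add: power_mult)
    finally show ?thesis
      unfolding pw by (simp add: L_def card)
  qed
  have "(\<lambda>t. real (num_partial_hadamard n (4 * t)) * (2 * pi * sqrt (real (4 * t))) ^ d / 2 ^ (n * (4 * t)) / L)
      \<longlonglongrightarrow> L / L"
    unfolding L_def assms(2)
    by (intro tendsto_divide num_partial_hadamard_limit tendsto_const)
       (use assms L in \<open>simp_all add: L_def\<close>)
  moreover have "eventually (\<lambda>t. real (num_partial_hadamard n (4 * t)) * (2 * pi * sqrt (real (4 * t))) ^ d / 2 ^ (n * (4 * t)) / L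
      = real (num_partial_hadamard n (4 * t)) / ?g t) sequentially"
    using eventually_gt_at_top[of 0]
  proof eventually_elim
    case (elim t)
    show ?case
      unfolding main_term[OF elim] by simp
  qed
  ultimately show "(\<lambda>t. real (num_partial_hadamard n (4 * t)) / ?g t) \<longlonglongrightarrow> 1"
    using L by (simp add: Lim_transform_eventually)
qed

end
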